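(* A monotone additively homogeneous map $T:\mathbb{R}^n\to\mathbb{R}^n$ has a slice space $\mathcal{A}_\alpha^\beta(T)$ (for some $\alpha,\beta\in\mathbb{R}$) that is unbounded in Hilbert's seminorm if and only if there exists a pair $(I,J)$ of nonempty disjoint subsets of $[n]$ such that $\operatorname{reach}(I^c,\mathcal{H}_\infty^+(T))=I^c$ and $\operatorname{reach}(J^c,\mathcal{H}_\infty^-(T))=J^c$.
   Context: $[n]=\{1,\dots,n\}$, $K^c=[n]\setminus K$, $e$ is the all-ones vector of $\mathbb{R}^n$, and $e_K$ is the vector with entries $1$ on $K\subset[n]$ and $0$ elsewhere. $T:\mathbb{R}^n\to\mathbb{R}^n$ is monotone if $x\le y\Rightarrow T(x)\le T(y)$ (componentwise order) and additively homogeneous if $T(x+\alpha e)=T(x)+\alpha e$ for all $\alpha\in\mathbb{R}$, $x\in\mathbb{R}^n$. Hilbert's seminorm is $\|x\|_{\mathrm H}=\max_i x_i-\min_i x_i$. Slice spaces: $\mathcal{A}_\alpha^\beta(T)=\{x\in\mathbb{R}^n\mid \alpha e+x\le T(x)\le\beta e+x\}$, $\alpha,\beta\in\mathbb{R}$. A directed hypergraph $\mathcal{H}=(N,A)$ has a set of nodes $N$ and a set $A$ of hyperarcs, each an ordered pair $(\mathbf{t},\mathbf{h})$ (tail, head) of disjoint nonempty subsets of $N$. Reachability is defined recursively: $j$ is reachable from $I\subset N$ if $j\in I$ or there is a hyperarc $(\mathbf{t},\mathbf{h})$ with $j\in\mathbf{h}$ and every node of $\mathbf{t}$ reachable from $I$.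 $\operatorname{reach}(I,\mathcal{H})$ is the set of nodes reachable from $I$. $\mathcal{H}_\infty^+(T)$ and $\mathcal{H}_\infty^-(T)$ have node set $[n]$. The hyperarcs of $\mathcal{H}_\infty^+(T)$ (resp. $\mathcal{H}_\infty^-(T)$) are the pairs $(J,\{i\})$ with $i\notin J$ and $\lim_{\alpha\to+\infty}T_i(\alpha e_J)=+\infty$ (resp. $\lim_{\alpha\to-\infty}T_i(\alpha e_J)=-\infty$). *)

theory Defs
  imports "HOL-Analysis.Analysis"
begin

text \<open>
  \<open>\<real>\<^sup>n\<close> is \<open>real ^ 'n\<close> for an arbitrary finite index type \<open>'n\<close>, so \<open>[n]\<close> is \<open>UNIV :: 'n set\<close> and
  \<open>K\<^sup>c\<close> is \<open>- K\<close>. The order \<open>\<le>\<close> on \<open>real ^ 'n\<close> is componentwise, monotonicity of \<open>T\<close> is \<open>mono T\<close>,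
  and the all-ones vector \<open>e\<close> is \<open>1 :: real ^ 'n\<close>.
\<close>

definition char_vec :: "'n set \<Rightarrow> real ^ 'n" where
  "char_vec K = (\<chi> i. if i \<in> K then 1 else 0)"

definition additively_homogeneous :: "(real ^ 'n \<Rightarrow> real ^ 'n) \<Rightarrow> bool" where
  "additively_homogeneous T \<longleftrightarrow> (\<forall>(\<alpha>::real) x. T (x + \<alpha> *\<^sub>R 1) = T x + \<alpha> *\<^sub>R 1)"

definition hilbert_seminorm :: "real ^ 'n \<Rightarrow> real" where
  "hilbert_seminorm x = Max (range (\<lambda>i. x $ i)) - Min (range (\<lambda>i. x $ i))"

definition hilbert_bounded :: "(real ^ 'n) set \<Rightarrow> bool" where
  "hilbert_bounded S \<longleftrightarrow> (\<exists>M. \<forall>x\<in>S. hilbert_seminorm x \<le> M)"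

definition slice_space :: "(real ^ 'n \<Rightarrow> real ^ 'n) \<Rightarrow> real \<Rightarrow> real \<Rightarrow> (real ^ 'n) set" where
  "slice_space T \<alpha> \<beta> = {x. \<alpha> *\<^sub>R 1 + x \<le> T x \<and> T x \<le> \<beta> *\<^sub>R 1 + x}"

text \<open>A hypergraph is a pair (nodes, hyperarcs); a hyperarc is a pair (tail, head).\<close>

type_synonym 'a hypergraph = "'a set \<times> ('a set \<times> 'a set) set"

definition directed_hypergraph :: "'a hypergraph \<Rightarrow> bool" where
  "directed_hypergraph H \<longleftrightarrow>
     (\<forall>(t, h) \<in> snd H. t \<subseteq> fst H \<and> h \<subseteq> fst H \<and> t \<noteq> {} \<and> h \<noteq> {} \<and> t \<inter> h = {})"

inductive_set reach :: "'a set \<Rightarrow> 'a hypergraph \<Rightarrow> 'a set"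
  for I :: "'a set" and H :: "'a hypergraph" where
  base: "j \<in> I \<Longrightarrow> j \<in> reach I H"
| step: "(t, h) \<in> snd H \<Longrightarrow> j \<in> h \<Longrightarrow> (\<And>k. k \<in> t \<Longrightarrow> k \<in> reach I H) \<Longrightarrow> j \<in> reach I H"

definition hypergraph_plus :: "(real ^ 'n \<Rightarrow> real ^ 'n) \<Rightarrow> 'n hypergraph" where
  "hypergraph_plus T =
     (UNIV, {(J, {i}) | J i. J \<noteq> {} \<and> i \<notin> J \<and>
               filterlim (\<lambda>\<alpha>::real. T (\<alpha> *\<^sub>R char_vec J) $ i) at_top at_top})"

definition hypergraph_minus :: "(real ^ 'n \<Rightarrow> real ^ 'n) \<Rightarrow> 'n hypergraph" where
  "hypergraph_minus T =
     (UNIV, {(J, {i}) | J i. J \<noteq> {} \<and> i \<notin> J \<and>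
               filterlim (\<lambda>\<alpha>::real. T (\<alpha> *\<^sub>R char_vec J) $ i) at_bot at_bot})"

lemma directed_hypergraph_plus: "directed_hypergraph (hypergraph_plus T)"
  by (auto simp: directed_hypergraph_def hypergraph_plus_def)

lemma directed_hypergraph_minus: "directed_hypergraph (hypergraph_minus T)"
  by (auto simp: directed_hypergraph_def hypergraph_minus_def)

end

theory Submission
  imports Defs
begin

text \<open>
  A set of nodes is reach-closed exactly when no hyperarc leaves it. By monotonicity, the largest
  tail inside \<open>- I\<close> is the one to test, so \<open>- I\<close> is closed in the hypergraph of \<open>T\<close> at \<open>+\<infinity>\<close> iff
  the coordinates \<open>T (s e_{-I}) $ i\<close>, \<open>i \<in> I\<close>, stay bounded as \<open>s\<close> grows
  (\<open>reach_compl_hypergraph_plus_iff_bounded\<close>). The hypergraph at \<open>-\<infinity>\<close> is the one at \<open>+\<infinity>\<close> of the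
  conjugate map \<open>x \<mapsto> - T (- x)\<close>, so each bound has a mirror image. The theorem thus compares
  unbounded slice spaces with pairs \<open>(I, J)\<close> of such bounds.

  From an unbounded slice space to \<open>(I, J)\<close>: along suitable points \<open>x\<close> of growing Hilbert seminorm,
  let \<open>I\<close> collect the coordinates that stay within bounded distance of the minimum and \<open>J\<close> those
  that stay within bounded distance of the maximum, all the others being arbitrarily far away
  (\<open>unbounded_family_clusters\<close>). After a translation, such an \<open>x\<close> lies above \<open>s e_{-I}\<close> with
  \<open>s\<close> as large as desired, while its coordinates in \<open>I\<close> remain bounded. The inequality
  \<open>T x \<le> \<beta> e + x\<close> read on \<open>I\<close> then bounds \<open>T (s e_{-I})\<close> there (\<open>bounded_on_cluster\<close>).

  From \<open>(I, J)\<close> to an unbounded slice space: for every \<open>s \<ge> 0\<close> there is a point of one fixed slice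
  space that equals \<open>0\<close> on \<open>I\<close> and \<open>s\<close> on \<open>J\<close>. It is obtained by prescribing these values
  and requiring, on the remaining coordinates, that \<open>x\<close> be the truncation of \<open>T x\<close> to
  \<open>[0, s]\<close>. This is a fixed point problem for a monotone map on an order interval, so Tarski's
  argument solves it (\<open>clamped_fixed_point\<close>). On \<open>I\<close> and \<open>J\<close> the hypotheses bound \<open>T x - x\<close>
  independently of \<open>s\<close>. Elsewhere truncation moves a coordinate of \<open>T x\<close> by at most the size of
  \<open>T 0\<close>, because \<open>T 0 \<le> T x \<le> T 0 + s e\<close>.
\<close>

section \<open>Monotone maps and Hilbert's seminorm\<close>

text \<open>
  Tarski's argument: the supremum of the points with \<open>x \<le> F x\<close> is fixed. Conditional completeness
  suffices because the interval bounds these points.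
\<close>

lemma fixed_point_of_monotone_map_on_interval:
  fixes F :: "'a::conditionally_complete_lattice \<Rightarrow> 'a"
  assumes "a \<le> b"
    and mono: "\<And>x y. a \<le> x \<Longrightarrow> x \<le> y \<Longrightarrow> y \<le> b \<Longrightarrow> F x \<le> F y"
    and range: "\<And>x. a \<le> x \<Longrightarrow> x \<le> b \<Longrightarrow> a \<le> F x \<and> F x \<le> b"
  obtains x where "a \<le> x" "x \<le> b" "F x = x"
proof -
  define P where "P = {x. a \<le> x \<and> x \<le> b \<and> x \<le> F x}"
  define z where "z = Sup P"
  have "a \<in> P"
    using assms(1) range by (auto simp: P_def)
  have bdd: "bdd_above P"
    by (rule bdd_aboveI[of _ b]) (auto simp: P_def)
  have az: "a \<le> z" and zb: "z \<le> b"
    using \<open>a \<in> P\<close> bdd unfolding z_def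
    by (auto intro: cSup_upper cSup_least simp: P_def)
  have zF: "z \<le> F z"
    unfolding z_def
  proof (rule cSup_least)
    show "P \<noteq> {}" using \<open>a \<in> P\<close> by auto
    fix x assume x: "x \<in> P"
    then have "x \<le> z" unfolding z_def by (rule cSup_upper[OF _ bdd])
    then have "F x \<le> F z" using x zb by (intro mono) (auto simp: P_def)
    then show "x \<le> F (Sup P)" using x by (auto simp: P_def z_def)
  qed
  have "F z \<in> P"
    using mono[of z "F z"] range[OF az zb] az zF by (auto simp: P_def)
  then have "F z \<le> z" unfolding z_def by (rule cSup_upper[OF _ bdd])
  then show thesis using that az zb zF by auto
qed

lemma additively_homogeneous_nth:
  assumes "additively_homogeneous T"
  shows "T (x + \<alpha> *\<^sub>R 1) $ i = T x $ i + \<alpha>"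
  using assms by (simp add: additively_homogeneous_def)

lemma diff_le_hilbert_seminorm:
  fixes x :: "real ^ 'n"
  shows "x $ i - x $ j \<le> hilbert_seminorm x"
proof -
  have "x $ i \<le> Max (range (\<lambda>i. x $ i))" "Min (range (\<lambda>i. x $ i)) \<le> x $ j"
    by (auto intro: Max_ge Min_le)
  then show ?thesis unfolding hilbert_seminorm_def by linarith
qed

lemma hilbert_seminorm_attained:
  fixes x :: "real ^ 'n"
  obtains i j where "hilbert_seminorm x = x $ i - x $ j"
proof -
  have "Max (range (\<lambda>i. x $ i)) \<in> range (\<lambda>i. x $ i)"
    "Min (range (\<lambda>i. x $ i)) \<in> range (\<lambda>i. x $ i)"
    by (auto intro!: Max_in Min_in)
  then obtain i j where "Max (range (\<lambda>i. x $ i)) = x $ i" "Min (range (\<lambda>i. x $ i)) = x $ j"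
    by (elim rangeE)
  then show thesis using that[of i j] unfolding hilbert_seminorm_def by linarith
qed

section \<open>Closed sets of the hypergraphs at infinity\<close>

text \<open>
  Conjugation by \<open>x \<mapsto> - x\<close> preserves monotonicity and additive homogeneity and exchanges the limits
  at \<open>+\<infinity>\<close> and \<open>-\<infinity>\<close>, so statements about the lower hypergraph reduce to the upper one.
\<close>

definition conjugate_map :: "(real ^ 'n \<Rightarrow> real ^ 'n) \<Rightarrow> real ^ 'n \<Rightarrow> real ^ 'n" where
  "conjugate_map T x = - T (- x)"

lemma mono_conjugate_map: "mono T \<Longrightarrow> mono (conjugate_map T)"
  by (auto simp: mono_def conjugate_map_def less_eq_vec_def)

lemma additively_homogeneous_conjugate_map:
  assumes "additively_homogeneous T"
  shows "additively_homogeneous (conjugate_map T)"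
  unfolding additively_homogeneous_def conjugate_map_def
proof (intro allI)
  fix \<alpha> :: real and x
  have "T (- x + (- \<alpha>) *\<^sub>R 1) = T (- x) + (- \<alpha>) *\<^sub>R 1"
    using assms unfolding additively_homogeneous_def by blast
  then show "- T (- (x + \<alpha> *\<^sub>R 1)) = - T (- x) + \<alpha> *\<^sub>R 1"
    by simp
qed

lemma hypergraph_minus_eq_plus_conjugate:
  "hypergraph_minus T = hypergraph_plus (conjugate_map T)"
proof -
  have "filterlim (\<lambda>\<alpha>::real. T (\<alpha> *\<^sub>R char_vec J) $ i) at_bot at_bot \<longleftrightarrow>
    filterlim (\<lambda>\<alpha>::real. conjugate_map T (\<alpha> *\<^sub>R char_vec J) $ i) at_top at_top" for J i
    by (simp add: conjugate_map_def filterlim_at_bot_mirror filterlim_uminus_at_top)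
  then show ?thesis
    by (simp add: hypergraph_minus_def hypergraph_plus_def)
qed

lemma reach_eq_iff_closed:
  "reach X H = X \<longleftrightarrow> (\<forall>(t, h) \<in> snd H. t \<subseteq> X \<longrightarrow> h \<subseteq> X)"
proof (intro iffI)
  assume eq: "reach X H = X"
  show "\<forall>(t, h) \<in> snd H. t \<subseteq> X \<longrightarrow> h \<subseteq> X"
    using eq reach.step[of _ _ H _ X] by blast
next
  assume closed: "\<forall>(t, h) \<in> snd H. t \<subseteq> X \<longrightarrow> h \<subseteq> X"
  have "j \<in> X" if "j \<in> reach X H" for j
    using that closed by (induction rule: reach.induct) blast+
  then show "reach X H = X"
    by (auto intro: reach.base)
qed

text \<open>
  The case \<open>s < 0\<close> is included, although \<open>s e_K\<close> then decreases with \<open>K\<close>: a nonpositive vector lies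
  below the nonnegative vector \<open>s' e_L\<close>.
\<close>

lemma mono_scaled_char_vec:
  assumes "mono T" "s \<le> s'" "0 \<le> s'" "K \<subseteq> L"
  shows "T (s *\<^sub>R char_vec K) $ i \<le> T (s' *\<^sub>R char_vec L) $ i"
proof -
  have "s *\<^sub>R char_vec K \<le> s' *\<^sub>R char_vec L"
    using assms(2-4) by (auto simp: less_eq_vec_def char_vec_def)
  then show ?thesis
    using assms(1) by (simp add: mono_def less_eq_vec_def)
qed

text \<open>
  Along \<open>s \<mapsto> s e_{-I}\<close> each coordinate of \<open>T\<close> is nondecreasing for \<open>s \<ge> 0\<close>, so it either tends to \<open>+\<infinity>\<close>
  or is bounded. A bound for the tail \<open>- I\<close> passes to all smaller tails. If \<open>I = UNIV\<close> both sides
  hold: hyperarcs have nonempty tails, and the vectors \<open>s e_{-I}\<close> are all \<open>0\<close>.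
\<close>

lemma reach_compl_hypergraph_plus_iff_bounded:
  fixes T :: "real ^ 'n \<Rightarrow> real ^ 'n"
  assumes "mono T"
  shows "reach (- I) (hypergraph_plus T) = - I \<longleftrightarrow>
    (\<exists>M. \<forall>i\<in>I. \<forall>s\<ge>0. T (s *\<^sub>R char_vec (- I)) $ i \<le> M)"
proof
  assume closed: "reach (- I) (hypergraph_plus T) = - I"
  have "\<exists>M. \<forall>s\<ge>0. T (s *\<^sub>R char_vec (- I)) $ i \<le> M" if "i \<in> I" for i
  proof -
    have "\<not> filterlim (\<lambda>s::real. T (s *\<^sub>R char_vec (- I)) $ i) at_top at_top"
    proof
      assume "filterlim (\<lambda>s::real. T (s *\<^sub>R char_vec (- I)) $ i) at_top at_top"
      moreover from this have "- I \<noteq> {}"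
      proof (rule contrapos_pn)
        assume "- I = {}"
        then have "T (s *\<^sub>R char_vec (- I)) $ i = T 0 $ i" for s
          by (simp add: char_vec_def zero_vec_def[symmetric])
        then show "\<not> filterlim (\<lambda>s::real. T (s *\<^sub>R char_vec (- I)) $ i) at_top at_top"
          using filterlim_at_top_dense[of "\<lambda>s::real. T 0 $ i" at_top] by auto
      qed
      ultimately have "(- I, {i}) \<in> snd (hypergraph_plus T)"
        using that by (auto simp: hypergraph_plus_def)
      then have "{i} \<subseteq> - I"
        using closed unfolding reach_eq_iff_closed by blast
      then show False using that by simp
    qed
    then obtain M where M: "\<not> eventually (\<lambda>s. M \<le> T (s *\<^sub>R char_vec (- I)) $ i) at_top"
      unfolding filterlim_at_top by blast
    have "T (s *\<^sub>R char_vec (- I)) $ i \<le> M" if "s \<ge> 0" for s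
    proof (rule ccontr)
      assume "\<not> ?thesis"
      then have "M \<le> T (s' *\<^sub>R char_vec (- I)) $ i" if "s' \<ge> s" for s'
        using mono_scaled_char_vec[OF assms that _ order_refl, of "- I" i] that \<open>s \<ge> 0\<close> by simp
      then show False using M unfolding eventually_at_top_linorder by blast
    qed
    then show ?thesis by blast
  qed
  then obtain M where M: "\<And>i s. i \<in> I \<Longrightarrow> s \<ge> 0 \<Longrightarrow> T (s *\<^sub>R char_vec (- I)) $ i \<le> M i"
    by metis
  have "T (s *\<^sub>R char_vec (- I)) $ i \<le> Max (range M)" if "i \<in> I" "s \<ge> 0" for i s
    using M[OF that] by (rule order_trans) simp
  then show "\<exists>M. \<forall>i\<in>I. \<forall>s\<ge>0. T (s *\<^sub>R char_vec (- I)) $ i \<le> M"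
    by blast
next
  assume "\<exists>M. \<forall>i\<in>I. \<forall>s\<ge>0. T (s *\<^sub>R char_vec (- I)) $ i \<le> M"
  then obtain M where M: "\<And>i s. i \<in> I \<Longrightarrow> s \<ge> 0 \<Longrightarrow> T (s *\<^sub>R char_vec (- I)) $ i \<le> M"
    by blast
  have False if i: "i \<in> I" and K: "K \<subseteq> - I"
    and lim: "filterlim (\<lambda>s::real. T (s *\<^sub>R char_vec K) $ i) at_top at_top" for i K
  proof -
    have "eventually (\<lambda>s. M + 1 \<le> T (s *\<^sub>R char_vec K) $ i \<and> 0 \<le> s) at_top"
      using lim eventually_ge_at_top[of "0::real"]
      unfolding filterlim_at_top by (auto intro: eventually_conj)
    then obtain s where s: "M + 1 \<le> T (s *\<^sub>R char_vec K) $ i" "0 \<le> s"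
      using eventually_happens'[OF trivial_limit_at_top_linorder] by blast
    then show False
      using M[OF i, of s] mono_scaled_char_vec[OF assms order_refl _ K, of s i] by simp
  qed
  then show "reach (- I) (hypergraph_plus T) = - I"
    unfolding reach_eq_iff_closed by (auto simp: hypergraph_plus_def)
qed

section \<open>Clusters of extreme coordinates\<close>

text \<open>
  The coordinates in \<open>I\<close> are minimal up to the error \<open>C\<close>, and a gap \<open>D\<close> separates them from all the
  others. Clusters of nearly maximal coordinates of \<open>x\<close> are the low clusters of \<open>- x\<close>.
\<close>

definition low_cluster :: "real \<Rightarrow> real \<Rightarrow> 'n set \<Rightarrow> real ^ 'n \<Rightarrow> bool" where
  "low_cluster C D I x \<longleftrightarrow>
     (\<forall>i\<in>I. (\<forall>k. x $ i \<le> x $ k + C) \<and> (\<forall>k. k \<notin> I \<longrightarrow> x $ i + D \<le> x $ k))"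

text \<open>
  The usual proof extracts subsequences along which each coordinate either stays near the extremum
  or escapes from it. A maximality argument replaces the extraction: among the pairs \<open>(I, J)\<close> that
  remain near the minimum and the maximum at points of arbitrarily large seminorm, with one constant
  \<open>C\<close>, take one of largest total cardinality. Adding any further index must fail for every
  constant, so at points of large seminorm every other index is far from the corresponding extremum.
\<close>

lemma unbounded_family_clusters:
  fixes S :: "(real ^ 'n) set"
  assumes "\<not> hilbert_bounded S"
  obtains I J C where "I \<noteq> {}" "J \<noteq> {}" "I \<inter> J = {}" "0 \<le> C"
    and "\<And>D. \<exists>x\<in>S. low_cluster C D I x \<and> low_cluster C D J (- x)"
proof -
  define near where "near C I J x \<longleftrightarrow>
    (\<forall>i\<in>I. \<forall>k. x $ i \<le> x $ k + C) \<and> (\<forall>j\<in>J. \<forall>k. x $ k \<le> x $ j + C)" for C I J and x :: "real ^ 'n"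
  define P where "P = (\<lambda>(I, J). \<exists>C. \<forall>M. \<exists>x\<in>S. M \<le> hilbert_seminorm x \<and> near C I J x)"
  have "\<exists>x\<in>S. M \<le> hilbert_seminorm x" for M
    using assms unfolding hilbert_bounded_def by (meson linear)
  then have P_empty: "P ({}, {})"
    by (simp add: P_def near_def)
  have card_le: "card A \<le> CARD('n)" for A :: "'n set"
    by (rule card_mono) auto
  have "card (fst IJ) + card (snd IJ) < Suc (CARD('n) + CARD('n))" for IJ :: "'n set \<times> 'n set"
    by (rule le_imp_less_Suc[OF add_mono[OF card_le card_le]])
  then have "\<exists>IJ. P IJ \<and> (\<forall>IJ'. P IJ' \<longrightarrow>
      card (fst IJ') + card (snd IJ') \<le> card (fst IJ) + card (snd IJ))"
    by (intro ex_has_greatest_nat[where P = P, OF P_empty] allI impI)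
  then obtain IJ where IJ: "P IJ"
    and max: "\<And>IJ'. P IJ' \<Longrightarrow> card (fst IJ') + card (snd IJ') \<le> card (fst IJ) + card (snd IJ)"
    by blast
  obtain I J where IJ_eq: "IJ = (I, J)" by (cases IJ)
  obtain C0 where C0: "\<And>M. \<exists>x\<in>S. M \<le> hilbert_seminorm x \<and> near C0 I J x"
    using IJ by (auto simp: P_def IJ_eq)
  have near_mono: "near C I J x \<Longrightarrow> C \<le> C' \<Longrightarrow> near C' I J x" for C C' I J x
    unfolding near_def by (meson add_left_mono order_trans)
  \<comment> \<open>\<open>C0\<close> can be negative as long as \<open>I\<close> and \<open>J\<close> might both be empty.\<close>
  define C where "C = max C0 0"
  have C: "\<exists>x\<in>S. M \<le> hilbert_seminorm x \<and> near C I J x" for M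
    using C0[of M] near_mono[of C0 I J _ C] by (auto simp: C_def)
  have noI: "\<exists>M. \<forall>x\<in>S. M \<le> hilbert_seminorm x \<longrightarrow> near C I J x \<longrightarrow> (\<exists>k. x $ k + D < x $ i)"
    if "i \<notin> I" for i D
  proof -
    \<comment> \<open>The constant \<open>max C D\<close> keeps the conditions on \<open>I\<close> and \<open>J\<close> true at the points where \<open>near C I J x\<close>
      holds, so that only the new index can violate them.\<close>
    have "\<not> P (insert i I, J)"
      using max[of "(insert i I, J)"] that by (auto simp: IJ_eq)
    then have "\<exists>M. \<forall>x\<in>S. M \<le> hilbert_seminorm x \<longrightarrow> \<not> near (max C D) (insert i I) J x"
      by (simp add: P_def)
    then obtain M where M: "\<And>x. x \<in> S \<Longrightarrow> M \<le> hilbert_seminorm x \<Longrightarrow> \<not> near (max C D) (insert i I) J x"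
      by blast
    have "\<exists>k. x $ k + D < x $ i" if x: "x \<in> S" "M \<le> hilbert_seminorm x" "near C I J x" for x
    proof -
      have "near (max C D) I J x"
        by (rule near_mono[OF x(3)]) simp
      then obtain k where "x $ k + max C D < x $ i"
        using M[OF x(1,2)] unfolding near_def not_le[symmetric] by blast
      then show ?thesis by (intro exI[of _ k]) simp
    qed
    then show ?thesis by blast
  qed
  have noJ: "\<exists>M. \<forall>x\<in>S. M \<le> hilbert_seminorm x \<longrightarrow> near C I J x \<longrightarrow> (\<exists>k. x $ j + D < x $ k)"
    if "j \<notin> J" for j D
  proof -
    have "\<not> P (I, insert j J)"
      using max[of "(I, insert j J)"] that by (auto simp: IJ_eq)
    then have "\<exists>M. \<forall>x\<in>S. M \<le> hilbert_seminorm x \<longrightarrow> \<not> near (max C D) I (insert j J) x"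
      by (simp add: P_def)
    then obtain M where M: "\<And>x. x \<in> S \<Longrightarrow> M \<le> hilbert_seminorm x \<Longrightarrow> \<not> near (max C D) I (insert j J) x"
      by blast
    have "\<exists>k. x $ j + D < x $ k" if x: "x \<in> S" "M \<le> hilbert_seminorm x" "near C I J x" for x
    proof -
      have "near (max C D) I J x"
        by (rule near_mono[OF x(3)]) simp
      then obtain k where "x $ j + max C D < x $ k"
        using M[OF x(1,2)] unfolding near_def not_le[symmetric] by blast
      then show ?thesis by (intro exI[of _ k]) simp
    qed
    then show ?thesis by blast
  qed
  have far: "\<exists>x\<in>S. near C I J x \<and> (\<forall>i. i \<notin> I \<longrightarrow> (\<exists>k. x $ k + D < x $ i)) \<and>
    (\<forall>j. j \<notin> J \<longrightarrow> (\<exists>k. x $ j + D < x $ k))" for D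
  proof -
    obtain m where m: "\<And>i x. i \<notin> I \<Longrightarrow> x \<in> S \<Longrightarrow> m i \<le> hilbert_seminorm x \<Longrightarrow> near C I J x
        \<Longrightarrow> \<exists>k. x $ k + D < x $ i"
      using noI[of _ D] by metis
    obtain m' where m': "\<And>j x. j \<notin> J \<Longrightarrow> x \<in> S \<Longrightarrow> m' j \<le> hilbert_seminorm x \<Longrightarrow> near C I J x
        \<Longrightarrow> \<exists>k. x $ j + D < x $ k"
      using noJ[of _ D] by metis
    obtain x where x: "x \<in> S" "near C I J x"
      and big: "max (Max (range m)) (Max (range m')) \<le> hilbert_seminorm x"
      using C by blast
    have "m i \<le> hilbert_seminorm x" "m' i \<le> hilbert_seminorm x" for i
      using big Max_ge[of "range m" "m i"] Max_ge[of "range m'" "m' i"] by auto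
    then show ?thesis
      using x big m m' by (intro bexI[of _ x]) auto
  qed
  \<comment> \<open>If \<open>I\<close> were empty, even a minimal coordinate would lie strictly above another one.\<close>
  have "I \<noteq> {}"
  proof
    assume "I = {}"
    then obtain x :: "real ^ 'n" where x: "\<forall>i. \<exists>k. x $ k < x $ i"
      using far[of 0] by auto
    have "Min (range (\<lambda>i. x $ i)) \<in> range (\<lambda>i. x $ i)"
      by (intro Min_in) auto
    then obtain i where i: "Min (range (\<lambda>i. x $ i)) = x $ i"
      by (rule rangeE)
    have "x $ i \<le> x $ k" for k
      unfolding i[symmetric] by (intro Min_le) auto
    then show False using x by (meson not_less)
  qed
  moreover have "J \<noteq> {}"
  proof
    assume "J = {}"
    then obtain x :: "real ^ 'n" where x: "\<forall>i. \<exists>k. x $ i < x $ k"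
      using far[of 0] by auto
    have "Max (range (\<lambda>i. x $ i)) \<in> range (\<lambda>i. x $ i)"
      by (intro Max_in) auto
    then obtain i where i: "Max (range (\<lambda>i. x $ i)) = x $ i"
      by (rule rangeE)
    have "x $ k \<le> x $ i" for k
      unfolding i[symmetric] by (intro Max_ge) auto
    then show False using x by (meson not_less)
  qed
  \<comment> \<open>An index near both extremes forces the seminorm to be at most \<open>2 * C\<close>.\<close>
  moreover have "I \<inter> J = {}"
  proof (rule ccontr)
    assume "I \<inter> J \<noteq> {}"
    then obtain l where l: "l \<in> I" "l \<in> J" by blast
    obtain x where x: "near C I J x" "2 * C + 1 \<le> hilbert_seminorm x"
      using C by blast
    obtain i j where "hilbert_seminorm x = x $ i - x $ j"
      by (rule hilbert_seminorm_attained)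
    moreover have "x $ l \<le> x $ j + C" "x $ i \<le> x $ l + C"
      using x(1) l by (auto simp: near_def)
    ultimately show False using x(2) by simp
  qed
  moreover have "0 \<le> C" by (simp add: C_def)
  moreover have "\<exists>x\<in>S. low_cluster C D I x \<and> low_cluster C D J (- x)" for D
  proof -
    \<comment> \<open>Distance \<open>D + C\<close> from the minimum leaves the gap \<open>D\<close> above every coordinate in \<open>I\<close>, as these
      exceed the minimum by at most \<open>C\<close>.\<close>
    obtain x where x: "x \<in> S" "near C I J x"
      and farI: "\<And>i. i \<notin> I \<Longrightarrow> \<exists>k. x $ k + (D + C) < x $ i"
      and farJ: "\<And>j. j \<notin> J \<Longrightarrow> \<exists>k. x $ j + (D + C) < x $ k"
      using far[of "D + C"] by blast
    have nI: "x $ i \<le> x $ k + C" if "i \<in> I" for i k using x(2) that by (auto simp: near_def)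
    have nJ: "x $ k \<le> x $ j + C" if "j \<in> J" for j k using x(2) that by (auto simp: near_def)
    have gapI: "x $ i + D \<le> x $ k" if "i \<in> I" "k \<notin> I" for i k
      using farI[OF that(2)] nI[OF that(1)] by (smt (verit))
    have gapJ: "x $ k + D \<le> x $ j" if "j \<in> J" "k \<notin> J" for j k
      using farJ[OF that(2)] nJ[OF that(1)] by (smt (verit))
    have "low_cluster C D I x"
      unfolding low_cluster_def using nI gapI by blast
    moreover have "low_cluster C D J (- x)"
      unfolding low_cluster_def
    proof (intro ballI conjI allI impI)
      fix j k
      assume j: "j \<in> J"
      show "(- x) $ j \<le> (- x) $ k + C"
        using nJ[OF j, of k] by simp
      show "(- x) $ j + D \<le> (- x) $ k" if "k \<notin> J"
        using gapJ[OF j that] by simp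
    qed
    ultimately show ?thesis using x(1) by blast
  qed
  ultimately show thesis by (rule that)
qed

text \<open>
  Translating \<open>x\<close> by \<open>C - x $ i\<close> places it above \<open>D e_{-I}\<close>, and the resulting bound does not
  involve \<open>D\<close>, which is what allows \<open>D\<close> to tend to infinity.
\<close>

lemma bounded_on_cluster:
  assumes "mono T" "additively_homogeneous T"
    and "T x $ i \<le> b + x $ i"
    and cluster: "low_cluster C D I x" "i \<in> I" and "0 \<le> C"
  shows "T (D *\<^sub>R char_vec (- I)) $ i \<le> b + C"
proof -
  have "D *\<^sub>R char_vec (- I) $ k \<le> x $ k + (C - x $ i)" for k
  proof -
    have "x $ i \<le> x $ k + C" "k \<notin> I \<Longrightarrow> x $ i + D \<le> x $ k"
      using cluster by (auto simp: low_cluster_def)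
    then show ?thesis
      using \<open>0 \<le> C\<close> by (cases "k \<in> I") (simp_all add: char_vec_def)
  qed
  then have "D *\<^sub>R char_vec (- I) \<le> x + (C - x $ i) *\<^sub>R 1"
    by (simp add: less_eq_vec_def)
  then have "T (D *\<^sub>R char_vec (- I)) $ i \<le> T (x + (C - x $ i) *\<^sub>R 1) $ i"
    using assms(1) by (simp add: mono_def less_eq_vec_def)
  also have "\<dots> = T x $ i + (C - x $ i)"
    by (rule additively_homogeneous_nth[OF assms(2)])
  finally show ?thesis using assms(3) by simp
qed

section \<open>Points of a slice space with prescribed extremes\<close>

lemma clamped_fixed_point:
  fixes T :: "real ^ 'n \<Rightarrow> real ^ 'n"
  assumes "mono T" "0 \<le> s" "I \<inter> J = {}"
  obtains x where "\<And>i. 0 \<le> x $ i" "\<And>i. x $ i \<le> s"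
    and "\<And>i. i \<in> I \<Longrightarrow> x $ i = 0" "\<And>j. j \<in> J \<Longrightarrow> x $ j = s"
    and "\<And>k. k \<notin> I \<Longrightarrow> k \<notin> J \<Longrightarrow> x $ k = max 0 (min s (T x $ k))"
proof -
  define F where "F x = (\<chi> k. if k \<in> I then 0 else if k \<in> J then s else max 0 (min s (T x $ k)))" for x
  have "F x \<le> F y" if "x \<le> y" for x y
  proof -
    have "T x $ k \<le> T y $ k" for k
      using monoD[OF assms(1) that] by (simp add: less_eq_vec_def)
    then have "max 0 (min s (T x $ k)) \<le> max 0 (min s (T y $ k))" for k
      by (intro max.mono min.mono order_refl)
    then show ?thesis by (simp add: F_def less_eq_vec_def)
  qed
  moreover have "0 \<le> F x \<and> F x \<le> s *\<^sub>R 1" for x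
    using assms(2) by (auto simp: F_def less_eq_vec_def)
  moreover have "(0 :: real ^ 'n) \<le> s *\<^sub>R 1"
    using assms(2) by (simp add: less_eq_vec_def)
  ultimately obtain x where x: "0 \<le> x" "x \<le> s *\<^sub>R 1" "F x = x"
    using fixed_point_of_monotone_map_on_interval[of 0 "s *\<^sub>R 1" F] by blast
  have eq: "x $ k = F x $ k" for k using x(3) by simp
  show thesis
  proof (rule that[of x])
    show "0 \<le> x $ i" "x $ i \<le> s" for i
      using x(1,2) by (simp_all add: less_eq_vec_def)
    show "x $ i = 0" if "i \<in> I" for i
      using eq[of i] that by (simp add: F_def)
    show "x $ j = s" if "j \<in> J" for j
      using eq[of j] that assms(3) by (auto simp: F_def)
    show "x $ k = max 0 (min s (T x $ k))" if "k \<notin> I" "k \<notin> J" for k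
      using eq[of k] that by (simp add: F_def)
  qed
qed

text \<open>
  The clamped fixed point with extremes \<open>0\<close> on \<open>I\<close> and \<open>s\<close> on \<open>J\<close> has Hilbert seminorm at least \<open>s\<close>,
  while the slice constant \<open>c\<close> depends only on the bound \<open>M\<close> and on \<open>T 0\<close>. The comparisons are
  \<open>x \<le> s e_{-I}\<close> on \<open>I\<close>, \<open>s e - s e_{-J} \<le> x\<close> on \<open>J\<close>, and \<open>0 \<le> x \<le> s e\<close> everywhere.
\<close>

lemma unbounded_slice_space_of_bounds:
  fixes T :: "real ^ 'n \<Rightarrow> real ^ 'n"
  assumes "mono T" "additively_homogeneous T"
    and "I \<noteq> {}" "J \<noteq> {}" "I \<inter> J = {}"
    and bdI: "\<And>i s. i \<in> I \<Longrightarrow> 0 \<le> s \<Longrightarrow> T (s *\<^sub>R char_vec (- I)) $ i \<le> M"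
    and bdJ: "\<And>j s. j \<in> J \<Longrightarrow> 0 \<le> s \<Longrightarrow> - M \<le> T (- s *\<^sub>R char_vec (- J)) $ j"
  shows "\<exists>c. \<not> hilbert_bounded (slice_space T (- c) c)"
proof (intro exI notI)
  define c where "c = max M (norm (T 0))"
  have T0: "\<bar>T 0 $ i\<bar> \<le> c" for i
    using component_le_norm_cart[of "T 0" i] by (simp add: c_def)
  assume "hilbert_bounded (slice_space T (- c) c)"
  then obtain R where R: "\<And>x. x \<in> slice_space T (- c) c \<Longrightarrow> hilbert_seminorm x \<le> R"
    by (auto simp: hilbert_bounded_def)
  define s where "s = max 0 R + 1"
  have "0 \<le> s" by (simp add: s_def)
  obtain x where x0: "\<And>i. 0 \<le> x $ i" and xs: "\<And>i. x $ i \<le> s"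
    and xI: "\<And>i. i \<in> I \<Longrightarrow> x $ i = 0" and xJ: "\<And>j. j \<in> J \<Longrightarrow> x $ j = s"
    and xK: "\<And>k. k \<notin> I \<Longrightarrow> k \<notin> J \<Longrightarrow> x $ k = max 0 (min s (T x $ k))"
    using clamped_fixed_point[OF assms(1) \<open>0 \<le> s\<close> assms(5)] by metis
  have Tmono: "u \<le> v \<Longrightarrow> T u $ k \<le> T v $ k" for u v k
    using assms(1) by (simp add: mono_def less_eq_vec_def)
  have lower: "- c \<le> T x $ k" for k
    using Tmono[of 0 x k] T0[of k] x0 by (simp add: less_eq_vec_def abs_le_iff)
  have upper: "T x $ k \<le> s + c" for k
    using Tmono[of x "0 + s *\<^sub>R 1" k] additively_homogeneous_nth[OF assms(2), of 0 s k] T0[of k] xs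
    by (simp add: less_eq_vec_def abs_le_iff)
  have upI: "T x $ i \<le> c" if "i \<in> I" for i
  proof -
    have "x \<le> s *\<^sub>R char_vec (- I)"
      using xs xI by (auto simp: less_eq_vec_def char_vec_def)
    from Tmono[OF this, of i] bdI[OF that \<open>0 \<le> s\<close>] show ?thesis by (simp add: c_def)
  qed
  have lowJ: "s - c \<le> T x $ j" if "j \<in> J" for j
  proof -
    have "- s *\<^sub>R char_vec (- J) + s *\<^sub>R 1 \<le> x"
      using x0 xJ by (auto simp: less_eq_vec_def char_vec_def)
    from Tmono[OF this, of j] bdJ[OF that \<open>0 \<le> s\<close>] show ?thesis
      unfolding additively_homogeneous_nth[OF assms(2)] by (simp add: c_def)
  qed
  have "- c + x $ k \<le> T x $ k \<and> T x $ k \<le> c + x $ k" for k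
  proof -
    consider "k \<in> I" | "k \<in> J" | "k \<notin> I" "k \<notin> J" by blast
    then show ?thesis
    proof cases
      case 1 then show ?thesis using xI lower[of k] upI by simp
    next
      case 2 then show ?thesis using xJ[of k] upper[of k] lowJ[of k] by simp
    next
      \<comment> \<open>Either \<open>T x $ k\<close> lies in \<open>[0, s]\<close> and equals \<open>x $ k\<close>, or it is truncated and exceeds
        \<open>[0, s]\<close> by at most \<open>c\<close>.\<close>
      case 3 then show ?thesis using xK[of k] upper[of k] lower[of k] \<open>0 \<le> s\<close> T0[of k]
        by (auto simp: max_def min_def split: if_splits)
    qed
  qed
  then have "x \<in> slice_space T (- c) c"
    by (simp add: slice_space_def less_eq_vec_def)
  then have "hilbert_seminorm x \<le> R" by (rule R)
  moreover obtain i j where "i \<in> I" "j \<in> J" using assms(3,4) by blast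
  ultimately show False
    using diff_le_hilbert_seminorm[of x j i] xI xJ by (simp add: s_def)
qed

section \<open>Unbounded slice spaces\<close>

theorem theorem4p2:
  fixes T :: "real ^ 'n \<Rightarrow> real ^ 'n"
  assumes "mono T"
    and "additively_homogeneous T"
  shows "(\<exists>\<alpha> \<beta> :: real. \<not> hilbert_bounded (slice_space T \<alpha> \<beta>)) \<longleftrightarrow>
    (\<exists>I J :: 'n set. I \<noteq> {} \<and> J \<noteq> {} \<and> I \<inter> J = {} \<and>
       reach (- I) (hypergraph_plus T) = - I \<and> reach (- J) (hypergraph_minus T) = - J)"
proof -
  let ?T' = "conjugate_map T"
  have T': "mono ?T'" "additively_homogeneous ?T'"
    using assms by (simp_all add: mono_conjugate_map additively_homogeneous_conjugate_map)
  have closed_iff: "reach (- I) (hypergraph_plus T) = - I \<and> reach (- J) (hypergraph_minus T) = - J \<longleftrightarrow>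
    (\<exists>M. \<forall>i\<in>I. \<forall>s\<ge>0. T (s *\<^sub>R char_vec (- I)) $ i \<le> M) \<and>
    (\<exists>M. \<forall>j\<in>J. \<forall>s\<ge>0. ?T' (s *\<^sub>R char_vec (- J)) $ j \<le> M)"
    for I J :: "'n set"
    unfolding hypergraph_minus_eq_plus_conjugate
    by (simp add: reach_compl_hypergraph_plus_iff_bounded assms(1) T'(1))
  show ?thesis
  proof
    assume "\<exists>\<alpha> \<beta> :: real. \<not> hilbert_bounded (slice_space T \<alpha> \<beta>)"
    then obtain \<alpha> \<beta> where unbounded: "\<not> hilbert_bounded (slice_space T \<alpha> \<beta>)" by blast
    obtain I J C where IJ: "I \<noteq> {}" "J \<noteq> {}" "I \<inter> J = {}" and C: "0 \<le> C"
      and clusters: "\<And>D. \<exists>x\<in>slice_space T \<alpha> \<beta>. low_cluster C D I x \<and> low_cluster C D J (- x)"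
      using unbounded_family_clusters[OF unbounded] by metis
    have "T (s *\<^sub>R char_vec (- I)) $ i \<le> \<beta> + C" if "i \<in> I" for i s
    proof -
      obtain x where "x \<in> slice_space T \<alpha> \<beta>" and cluster: "low_cluster C s I x"
        using clusters[of s] by blast
      then have "T x $ i \<le> \<beta> + x $ i"
        by (simp add: slice_space_def less_eq_vec_def)
      then show ?thesis
        by (rule bounded_on_cluster[OF assms _ cluster that C])
    qed
    moreover have "?T' (s *\<^sub>R char_vec (- J)) $ j \<le> - \<alpha> + C" if "j \<in> J" for j s
    proof -
      obtain x where x: "x \<in> slice_space T \<alpha> \<beta>" and cluster: "low_cluster C s J (- x)"
        using clusters[of s] by blast
      have "\<alpha> + x $ j \<le> T x $ j"
        using x by (simp add: slice_space_def less_eq_vec_def)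
      then have "?T' (- x) $ j \<le> - \<alpha> + (- x) $ j"
        by (simp add: conjugate_map_def)
      then show ?thesis
        by (rule bounded_on_cluster[OF T' _ cluster that C])
    qed
    ultimately have "reach (- I) (hypergraph_plus T) = - I \<and> reach (- J) (hypergraph_minus T) = - J"
      unfolding closed_iff by blast
    then show "\<exists>I J :: 'n set. I \<noteq> {} \<and> J \<noteq> {} \<and> I \<inter> J = {} \<and>
       reach (- I) (hypergraph_plus T) = - I \<and> reach (- J) (hypergraph_minus T) = - J"
      using IJ by blast
  next
    assume "\<exists>I J :: 'n set. I \<noteq> {} \<and> J \<noteq> {} \<and> I \<inter> J = {} \<and>
       reach (- I) (hypergraph_plus T) = - I \<and> reach (- J) (hypergraph_minus T) = - J"
    then obtain I J :: "'n set" where IJ: "I \<noteq> {}" "J \<noteq> {}" "I \<inter> J = {}"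
      and "reach (- I) (hypergraph_plus T) = - I \<and> reach (- J) (hypergraph_minus T) = - J"
      by blast
    then obtain M M' where M: "\<And>i s. i \<in> I \<Longrightarrow> 0 \<le> s \<Longrightarrow> T (s *\<^sub>R char_vec (- I)) $ i \<le> M"
      and M': "\<And>j s. j \<in> J \<Longrightarrow> 0 \<le> s \<Longrightarrow> ?T' (s *\<^sub>R char_vec (- J)) $ j \<le> M'"
      unfolding closed_iff by blast
    have "T (s *\<^sub>R char_vec (- I)) $ i \<le> max M M'" if "i \<in> I" "0 \<le> s" for i s
      using M[OF that] by simp
    moreover have "- max M M' \<le> T (- s *\<^sub>R char_vec (- J)) $ j" if "j \<in> J" "0 \<le> s" for j s
      using M'[OF that] by (simp add: conjugate_map_def)
    ultimately show "\<exists>\<alpha> \<beta> :: real. \<not> hilbert_bounded (slice_space T \<alpha> \<beta>)"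
      using unbounded_slice_space_of_bounds[OF assms IJ] by blast
  qed
qed

end
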